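(* Let $G$ be a finite simple graph with $m$ edges. Then the minimum degree of the skeleton $\mathcal{G}(\mathcal{M}(G))$ of the matching polytope of $G$ equals $m$.
   Context: A matching of $G=(V,E)$ is a set of pairwise disjoint edges (the empty set included). For $F\subseteq E$, $\chi_F\in\mathbb{R}^E$ is the incidence vector of $F$. The matching polytope $\mathcal{M}(G)$ is the convex hull of $\{\chi_M : M \text{ a matching of } G\}$, whose vertices are exactly these vectors. The skeleton $\mathcal{G}(\mathcal{M}(G))$ is the graph whose vertices and edges are the vertices and edges (1-dimensional faces) of $\mathcal{M}(G)$. *)

theory Defs
  imports "HOL-Analysis.Analysis"
begin

type_synonym 'a sgraph = "'a set \<times> 'a set set"

abbreviation verts :: "'a sgraph \<Rightarrow> 'a set" where
  "verts G \<equiv> fst G"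

abbreviation edges :: "'a sgraph \<Rightarrow> 'a set set" where
  "edges G \<equiv> snd G"

definition finite_simple_graph :: "'a sgraph \<Rightarrow> bool" where
  "finite_simple_graph G \<longleftrightarrow>
     finite (verts G) \<and> (\<forall>e \<in> edges G. e \<subseteq> verts G \<and> card e = 2)"

definition degree :: "'a sgraph \<Rightarrow> 'a \<Rightarrow> nat" where
  "degree G v = card {e \<in> edges G. v \<in> e}"

text \<open>Meaningful only for graphs with a finite, nonempty vertex set.\<close>

definition min_degree :: "'a sgraph \<Rightarrow> nat" where
  "min_degree G = Min (degree G ` verts G)"

definition matching :: "'a sgraph \<Rightarrow> 'a set set \<Rightarrow> bool" where
  "matching G M \<longleftrightarrow> M \<subseteq> edges G \<and> pairwise disjnt M"

text \<open>
  The space of real vectors indexed by the edge set of a graph is realised as a coordinate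
  subspace of the space indexed by all sets of vertices. All coordinates outside the edge set
  vanish on incidence vectors of sets of edges, hence on the matching polytope; faces and their
  affine dimensions do not depend on the ambient space.
\<close>

definition incidence_vector :: "'a::finite set set \<Rightarrow> real ^ 'a set" where
  "incidence_vector F = (\<chi> e. if e \<in> F then 1 else 0)"

definition matching_polytope :: "'a::finite sgraph \<Rightarrow> (real ^ 'a set) set" where
  "matching_polytope G = convex hull {incidence_vector M | M. matching G M}"

text \<open>
  An edge of a polytope, i.e. a face of dimension one, is recorded in the skeleton as the set of
  its two end points, which are its extreme points.
\<close>

definition skeleton :: "'n::euclidean_space set \<Rightarrow> 'n sgraph" where
  "skeleton P =
     ({v. v extreme_point_of P}, {{v. v extreme_point_of F} | F. F edge_of P})"

end

theory Submission
  imports Defs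
begin

text \<open>
  Every matching \<open>M\<close> has \<open>m\<close> distinct neighbours: for each edge \<open>e\<close>, delete \<open>e\<close> from \<open>M\<close> if it
  belongs to \<open>M\<close>, and otherwise add \<open>e\<close> and delete the edges of \<open>M\<close> that meet it. Adjacency is
  witnessed by an explicit linear functional that is maximised exactly at the two matchings.
  Conversely, the empty matching has no other neighbours: if \<open>e \<in> N\<close>, then
  \<open>0 + \<chi>\<^sub>N = \<chi>\<^bsub>{e}\<^esub> + \<chi>\<^bsub>N - {e}\<^esub>\<close>, so every face containing \<open>0\<close> and \<open>\<chi>\<^sub>N\<close> contains \<open>\<chi>\<^bsub>{e}\<^esub>\<close>.
\<close>

section \<open>Faces of convex hulls and edges of polytopes\<close>

lemma convex_hull_face_of_maximizers:
  fixes V :: "'n::euclidean_space set"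
  assumes "finite V" "W \<subseteq> V"
    and eq: "\<And>v. v \<in> W \<Longrightarrow> c \<bullet> v = b"
    and less: "\<And>v. v \<in> V - W \<Longrightarrow> c \<bullet> v < b"
  shows "convex hull W face_of convex hull V"
proof -
  let ?F = "convex hull V \<inter> {x. c \<bullet> x = b}"
  have "V \<subseteq> {x. c \<bullet> x \<le> b}"
    using eq less by (auto simp: less_eq_real_def)
  then have "convex hull V \<subseteq> {x. c \<bullet> x \<le> b}"
    by (simp add: convex_halfspace_le hull_minimal)
  then have face: "?F face_of convex hull V"
    by (intro face_of_Int_supporting_hyperplane_le) auto
  \<comment> \<open>A face of the hull of a finite set is spanned by some of its points. These
    attain the value \<open>b\<close>, and no point of \<open>V - W\<close> does, so
    \<open>T\<close> lies in \<open>W\<close>.\<close>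
  then obtain T where T: "T \<subseteq> V" "?F = convex hull T"
    using face_of_convex_hull_subset[OF finite_imp_compact[OF \<open>finite V\<close>]] by blast
  then have "T \<subseteq> ?F"
    using hull_subset by metis
  then have "T \<subseteq> W"
    using T less by fastforce
  moreover have "convex hull W \<subseteq> ?F"
    using assms by (intro hull_minimal convex_Int convex_convex_hull convex_hyperplane)
      (auto simp: hull_inc)
  ultimately have "?F = convex hull W"
    using T hull_mono[of T W convex] by auto
  then show ?thesis
    using face by simp
qed

lemma edge_of_polytope_segment:
  fixes P :: "'n::euclidean_space set"
  assumes "polytope P" "F edge_of P"
  obtains a b where "a \<noteq> b" "F = closed_segment a b"
proof -
  have F: "F face_of P" "aff_dim F = 1"
    using assms by (auto simp: edge_of_def)
  then have "polytope F"
    using assms face_of_polytope_polytope by blast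
  moreover have "F \<noteq> {}"
    using F by auto
  ultimately obtain a b where "F = closed_segment a b"
    using F compact_convex_collinear_segment[of F]
    by (metis collinear_aff_dim order_refl polytope_imp_compact polytope_imp_convex)
  moreover have "a \<noteq> b"
    using F calculation by auto
  ultimately show thesis
    using that by blast
qed

lemma closed_segment_face_imp_edge_of:
  fixes P :: "'n::euclidean_space set"
  assumes "closed_segment a b face_of P" "a \<noteq> b"
  shows "closed_segment a b edge_of P"
  using assms by (simp add: edge_of_def segment_convex_hull aff_dim_convex_hull aff_dim_2)

section \<open>Incidence vectors and linear functionals on them\<close>

lemma inner_incidence_vector: "(\<chi> f. w f) \<bullet> incidence_vector X = sum w X"
proof -
  have "(\<chi> f. w f) \<bullet> incidence_vector X = (\<Sum>f\<in>UNIV. if f \<in> X then w f else 0)"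
    unfolding incidence_vector_def inner_vec_def by (intro sum.cong) auto
  then show ?thesis
    by (simp add: sum.If_cases)
qed

lemma incidence_vector_eq_iff [simp]:
  "incidence_vector X = incidence_vector Y \<longleftrightarrow> X = Y"
  by (auto simp: incidence_vector_def vec_eq_iff split: if_splits)

lemma incidence_vector_Un_disjoint:
  assumes "X \<inter> Y = {}"
  shows "incidence_vector (X \<union> Y) = incidence_vector X + incidence_vector Y"
  using assms by (auto simp: incidence_vector_def vec_eq_iff)

text \<open>The sum counts \<open>X \<inter> M\<close> minus \<open>X - M\<close>, so these sign
  weights have \<open>M\<close> as their unique maximiser among all sets.\<close>

lemma sum_sign_less_card:
  fixes X M :: "'b::finite set"
  assumes "X \<noteq> M"
  shows "(\<Sum>f\<in>X. if f \<in> M then 1 else - 1 :: real) < card M"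
proof -
  have sum: "(\<Sum>f\<in>X. if f \<in> M then 1 else - 1 :: real) = real (card (X \<inter> M)) - card (X - M)"
    by (simp add: sum.If_cases Diff_eq)
  have le: "card (X \<inter> M) \<le> card M"
    by (simp add: card_mono)
  show ?thesis
  proof (cases "X \<subseteq> M")
    case True
    then have "card (X \<inter> M) < card M"
      using assms by (intro psubset_card_mono) auto
    then show ?thesis
      unfolding sum by linarith
  next
    case False
    then have "card (X - M) > 0"
      by (simp add: card_gt_0_iff)
    then show ?thesis
      unfolding sum using le by linarith
  qed
qed

section \<open>Exchanging along one edge\<close>

definition exchange :: "'a set set \<Rightarrow> 'a set \<Rightarrow> 'a set set" where
  "exchange M e = (if e \<in> M then M - {e} else insert e {f \<in> M. disjnt f e})"

lemma exchange_neq: "exchange M e \<noteq> M"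
  by (auto simp: exchange_def)

text \<open>The edge can be read off from the result: it is the only element added to
  \<open>M\<close>, or, if nothing was added, the only element removed.\<close>

lemma inj_exchange: "inj (exchange M)"
proof (rule injI)
  fix d e
  assume eq: "exchange M d = exchange M e"
  have "exchange M f - M \<union> (M - exchange M f) = {f}" if "f \<in> M" for f
    using that by (auto simp: exchange_def)
  moreover have "exchange M f - M = {f}" if "f \<notin> M" for f
    using that by (auto simp: exchange_def)
  moreover have "exchange M f - M = {}" if "f \<in> M" for f
    using that by (auto simp: exchange_def)
  ultimately show "d = e"
    using eq by (metis insert_not_empty singleton_inject)
qed

context
  fixes G :: "'a::finite sgraph"
begin

section \<open>Faces, vertices and edges of the matching polytope\<close>

lemma matching_subset: "matching G M \<Longrightarrow> N \<subseteq> M \<Longrightarrow> matching G N"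
  by (auto simp: matching_def intro: pairwise_subset)

lemma matching_exchange: "matching G M \<Longrightarrow> e \<in> edges G \<Longrightarrow> matching G (exchange M e)"
  by (auto simp: matching_def exchange_def pairwise_def disjnt_iff)

lemma polytope_matching_polytope: "polytope (matching_polytope G)"
  unfolding matching_polytope_def by (simp add: polytope_convex_hull)

text \<open>This reduces geometry to combinatorics: a face is exhibited by edge weights whose
  maximum-weight matchings are exactly the members of \<open>A\<close>.\<close>

lemma matching_polytope_faceI:
  fixes w :: "'a set \<Rightarrow> real"
  assumes "\<And>X. X \<in> A \<Longrightarrow> matching G X"
    and "\<And>X. X \<in> A \<Longrightarrow> sum w X = b"
    and "\<And>X. matching G X \<Longrightarrow> X \<notin> A \<Longrightarrow> sum w X < b"
  shows "convex hull (incidence_vector ` A) face_of matching_polytope G"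
  unfolding matching_polytope_def
  by (rule convex_hull_face_of_maximizers[where c = "\<chi> f. w f" and b = b])
    (use assms in \<open>auto simp: inner_incidence_vector image_iff\<close>)

lemma extreme_point_of_matching_polytope:
  "v extreme_point_of matching_polytope G \<longleftrightarrow> (\<exists>M. matching G M \<and> v = incidence_vector M)"
proof
  show "\<exists>M. matching G M \<and> v = incidence_vector M" if "v extreme_point_of matching_polytope G"
    using extreme_point_of_convex_hull that unfolding matching_polytope_def by fastforce
next
  assume "\<exists>M. matching G M \<and> v = incidence_vector M"
  then obtain M where M: "matching G M" "v = incidence_vector M"
    by blast
  have "convex hull (incidence_vector ` {M}) face_of matching_polytope G"
    by (rule matching_polytope_faceI
        [where w = "\<lambda>f. if f \<in> M then 1 else - 1" and b = "card M"])
      (use M sum_sign_less_card in auto)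
  then show "v extreme_point_of matching_polytope G"
    using M by (simp add: face_of_singleton)
qed

lemma exchange_segment_face_of_if_notin:
  assumes M: "matching G M" and e: "e \<in> edges G" "e \<notin> M"
  shows "closed_segment (incidence_vector M) (incidence_vector (exchange M e))
    face_of matching_polytope G"
proof -
  define L where "L = {f \<in> M. disjnt f e}"
  \<comment> \<open>The weight of \<open>e\<close> is the number of edges of \<open>M\<close> that
    it displaces, so \<open>M\<close> and \<open>insert e L\<close> tie. Without \<open>e\<close>,
    the sign weights favour \<open>M\<close> alone.\<close>
  define w where "w f = (if f = e then real (card (M - L)) else if f \<in> M then 1 else - 1)" for f
  have L: "L \<subseteq> M" "e \<notin> L" "exchange M e = insert e L"
    using e by (auto simp: L_def exchange_def)
  have card: "real (card (M - L)) + card L = card M"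
    using L by (simp add: card_Diff_subset card_mono)
  have "sum w M = (\<Sum>f\<in>M. 1)"
    using e by (intro sum.cong) (auto simp: w_def)
  then have sum_M: "sum w M = card M"
    by simp
  have "sum w L = (\<Sum>f\<in>L. 1)"
    using L by (intro sum.cong) (auto simp: w_def)
  then have sum_N: "sum w (insert e L) = card M"
    using L card by (simp add: w_def)
  have less: "sum w X < card M" if X: "matching G X" "X \<noteq> M" "X \<noteq> insert e L" for X
  proof (cases "e \<in> X")
    case True
    \<comment> \<open>A matching containing \<open>e\<close> can keep only those edges of
      \<open>M\<close> that are disjoint from \<open>e\<close>. On the rest of \<open>X\<close> the
      weights are thus the sign weights of \<open>L\<close>, uniquely maximised by
      \<open>L\<close>.\<close>
    have disj: "f \<in> L" if "f \<in> X" "f \<in> M" for f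
      using that X(1) True e pairwiseD[of disjnt X f e] by (auto simp: L_def matching_def)
    have "sum w (X - {e}) = (\<Sum>f\<in>X - {e}. if f \<in> L then 1 else - 1)"
      using disj L by (intro sum.cong) (auto simp: w_def)
    also have "\<dots> < card L"
      using X True L by (intro sum_sign_less_card) auto
    finally have "sum w (X - {e}) < card L" .
    moreover have "w e = card (M - L)"
      by (simp add: w_def)
    ultimately show ?thesis
      using card sum.remove[OF finite True, of w] by linarith
  next
    case False
    then have "sum w X = (\<Sum>f\<in>X. if f \<in> M then 1 else - 1)"
      by (intro sum.cong) (auto simp: w_def)
    then show ?thesis
      using sum_sign_less_card[OF X(2)] by simp
  qed
  have "convex hull (incidence_vector ` {M, exchange M e}) face_of matching_polytope G"
  proof (rule matching_polytope_faceI)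
    show "matching G X" if "X \<in> {M, exchange M e}" for X
      using that M matching_exchange[OF M e(1)] by blast
    show "sum w X = card M" if "X \<in> {M, exchange M e}" for X
      using that sum_M sum_N L(3) by auto
    show "sum w X < card M" if "matching G X" "X \<notin> {M, exchange M e}" for X
      using that less L(3) by simp
  qed
  then show ?thesis
    by (simp add: segment_convex_hull)
qed

lemma exchange_segment_edge_of:
  assumes M: "matching G M" and e: "e \<in> edges G"
  shows "closed_segment (incidence_vector M) (incidence_vector (exchange M e))
    edge_of matching_polytope G"
proof (rule closed_segment_face_imp_edge_of)
  show "incidence_vector M \<noteq> incidence_vector (exchange M e)"
    using exchange_neq[of M e] by simp
  show "closed_segment (incidence_vector M) (incidence_vector (exchange M e))
    face_of matching_polytope G"
  proof (cases "e \<in> M")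
    case True
    \<comment> \<open>Deleting \<open>e\<close> is undone by inserting it again, since
      \<open>e\<close> meets no other edge of \<open>M\<close>. The segment is therefore one from
      the insertion case, reversed.\<close>
    have "disjnt f e" if "f \<in> M - {e}" for f
      using that M True by (auto simp: matching_def pairwise_def)
    then have "exchange (M - {e}) e = M" "exchange M e = M - {e}"
      using True by (auto simp: exchange_def)
    moreover have "matching G (M - {e})"
      using matching_subset[OF M] by blast
    ultimately show ?thesis
      using exchange_segment_face_of_if_notin[of "M - {e}" e] e
      by (subst closed_segment_commute) simp
  next
    case False
    then show ?thesis
      using exchange_segment_face_of_if_notin M e by blast
  qed
qed

section \<open>Degrees in the skeleton\<close>

lemma finite_skeleton_edges: "finite (edges (skeleton (matching_polytope G)))"
proof (rule finite_subset)
  show "edges (skeleton (matching_polytope G)) \<subseteq> Pow {incidence_vector M | M. matching G M}"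
    by (auto simp: skeleton_def edge_of_def extreme_point_of_face
        extreme_point_of_matching_polytope)
qed simp

lemma degree_skeleton_ge:
  assumes M: "matching G M"
  shows "card (edges G) \<le> degree (skeleton (matching_polytope G)) (incidence_vector M)"
  unfolding degree_def
proof (rule card_inj_on_le)
  let ?g = "\<lambda>e. {incidence_vector M, incidence_vector (exchange M e)}"
  show "inj_on ?g (edges G)"
    by (simp add: inj_on_def doubleton_eq_iff exchange_neq inj_eq[OF inj_exchange])
  have "?g e \<in> edges (skeleton (matching_polytope G))" if "e \<in> edges G" for e
  proof -
    have "?g e = {v. v extreme_point_of
        closed_segment (incidence_vector M) (incidence_vector (exchange M e))}"
      by (auto simp: extreme_point_of_segment)
    then show ?thesis
      using exchange_segment_edge_of[OF M that] unfolding skeleton_def snd_conv by blast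
  qed
  then show "?g ` edges G \<subseteq>
      {S \<in> edges (skeleton (matching_polytope G)). incidence_vector M \<in> S}"
    by blast
  \<comment> \<open>Finiteness matters because \<open>card\<close> is 0 on infinite sets.\<close>
  show "finite {S \<in> edges (skeleton (matching_polytope G)). incidence_vector M \<in> S}"
    using finite_skeleton_edges by simp
qed

lemma singleton_in_face_of_matching_polytope:
  assumes F: "F face_of matching_polytope G" and N: "matching G N" "e \<in> N"
    and "incidence_vector {} \<in> F" "incidence_vector N \<in> F"
  shows "incidence_vector {e} \<in> F"
proof (cases "N = {e}")
  case False
  let ?a = "incidence_vector {e}" and ?b = "incidence_vector (N - {e})"
  have zero: "incidence_vector {} = 0"
    by (simp add: incidence_vector_def vec_eq_iff)
  have "incidence_vector N = ?a + ?b"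
    using incidence_vector_Un_disjoint[of "{e}" "N - {e}"] N by (simp add: insert_absorb)
  \<comment> \<open>Halving the identity gives two segments with a common midpoint. It lies in
    \<open>F\<close> by convexity, and the defining property of a face then puts \<open>?a\<close>
    in \<open>F\<close>.\<close>
  then have "midpoint ?a ?b = midpoint (incidence_vector {}) (incidence_vector N)"
    by (simp add: midpoint_def zero)
  moreover have "midpoint (incidence_vector {}) (incidence_vector N) \<in> F"
    using assms face_of_imp_convex[OF F]
    by (meson closed_segment_subset midpoint_in_closed_segment subsetD)
  moreover have "midpoint ?a ?b \<in> open_segment ?a ?b"
    by (auto simp: midpoint_in_open_segment)
  moreover have "?a \<in> matching_polytope G" "?b \<in> matching_polytope G"
    using matching_subset[OF N(1)] N(2) extreme_point_of_matching_polytope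
    by (auto simp: extreme_point_of_def)
  ultimately show ?thesis
    using face_ofD[OF F] by metis
qed (use assms in simp)

lemma degree_skeleton_empty_le:
  "degree (skeleton (matching_polytope G)) (incidence_vector {}) \<le> card (edges G)"
  unfolding degree_def
proof (rule surj_card_le)
  show "finite (edges G)"
    by simp
  show "{S \<in> edges (skeleton (matching_polytope G)). incidence_vector {} \<in> S}
    \<subseteq> (\<lambda>e. {incidence_vector {}, incidence_vector {e}}) ` edges G"
  proof
    fix S
    assume "S \<in> {S \<in> edges (skeleton (matching_polytope G)). incidence_vector {} \<in> S}"
    then obtain F where F: "F edge_of matching_polytope G" "S = {v. v extreme_point_of F}"
      and S: "incidence_vector {} \<in> S"
      by (auto simp: skeleton_def)
    have face: "F face_of matching_polytope G"
      using F by (simp add: edge_of_def)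
    obtain a b where ab: "a \<noteq> b" "F = closed_segment a b"
      using edge_of_polytope_segment[OF polytope_matching_polytope F(1)] .
    then have S_ab: "S = {a, b}"
      using F by (auto simp: extreme_point_of_segment)
    \<comment> \<open>The extreme points of a face are the vertices of the polytope lying in it. So
      once \<open>incidence_vector {e}\<close> is in \<open>F\<close>, it must be the second of the
      two end points.\<close>
    have ext: "v \<in> S \<longleftrightarrow> v \<in> F \<and> (\<exists>N. matching G N \<and> v = incidence_vector N)" for v
      using F extreme_point_of_face[OF face] extreme_point_of_matching_polytope by auto
    obtain v where "v \<in> S" "v \<noteq> incidence_vector {}"
      using S_ab ab by auto
    then obtain N where N: "matching G N" "incidence_vector N \<in> F" "N \<noteq> {}"
      using ext by auto
    then obtain e where e: "e \<in> N"
      by blast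
    have "incidence_vector {e} \<in> F"
      using singleton_in_face_of_matching_polytope[OF face N(1) e] S N ext by blast
    then have "incidence_vector {e} \<in> S"
      using ext matching_subset[OF N(1), of "{e}"] e by auto
    moreover have "incidence_vector {e} \<noteq> incidence_vector {}"
      by simp
    ultimately have "S = {incidence_vector {}, incidence_vector {e}}"
      using S S_ab by auto
    moreover have "e \<in> edges G"
      using N e by (auto simp: matching_def)
    ultimately show "S \<in> (\<lambda>e. {incidence_vector {}, incidence_vector {e}}) ` edges G"
      by blast
  qed
qed

end

theorem theorem3p2:
  fixes G :: "'a::finite sgraph" and m :: nat
  assumes "finite_simple_graph G"
    and "card (edges G) = m"
  shows "min_degree (skeleton (matching_polytope G)) = m"
proof -
  let ?K = "skeleton (matching_polytope G)"
  have verts: "verts ?K = incidence_vector ` {M. matching G M}"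
    by (auto simp: skeleton_def extreme_point_of_matching_polytope)
  \<comment> \<open>The empty matching is a vertex of every matching polytope, and the minimum is
    attained there.\<close>
  have "matching G {}"
    by (simp add: matching_def)
  moreover from this have "degree ?K (incidence_vector {}) = m"
    using degree_skeleton_ge[of G "{}"] degree_skeleton_empty_le[of G] assms(2) by simp
  ultimately show ?thesis
    unfolding min_degree_def verts using degree_skeleton_ge[of G] assms(2)
    by (intro Min_eqI) auto
qed

end
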